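(* Let $X$ be a real Banach space, $\emptyset\ne D\subset X$ open, $Y$ a real Hilbert space with scalar product $a$, $B\in C^1(D;Y^* )$, $F\in Y^*$, and let $X_h\subset X$, $Y_h\subset Y$ be finite-dimensional subspaces, $D_h:=D\cap X_h$. Write $b(x;\eta):=\langle B(x),\eta\rangle$ and $b'(x;\xi,\eta):=\langle \mathrm{D}B(x)\xi,\eta\rangle$. (a) Suppose $x_h\in D_h$ is a stationary point of the dPG discretization (in the sense defined in the context) and $y_h\in Y_h$ is the Riesz representation of the residual in $Y_h$, i.e. $a(y_h,\eta_h)=F(\eta_h)-b(x_h;\eta_h)$ for all $\eta_h\in Y_h$. Then $(x_h,y_h)$ solves the mixed problem $$a(y_h,\eta_h)+b(x_h;\eta_h)=F(\eta_h)\ \text{ for all }\eta_h\in Y_h,\qquad b'(x_h;\xi_h,y_h)=0\ \text{ for all }\xi_h\in X_h .\tag{M}$$ (b) Conversely, if $(x_h,y_h)\in D_h\times Y_h$ solves (M), then $x_h$ is a stationary point of the dPG discretization.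
   Context: $Y$ is normed by $\|y\|_Y=a(y,y)^{1/2}$; $\mathrm{D}B(x)\in L(X;Y^* )$ is the Fréchet derivative of $B$ at $x$, and $\langle\cdot,\cdot\rangle$ is the duality bracket of $Y^*$ and $Y$. For a functional $G\in Y^*$, $\|G\|_{Y_h^*}:=\sup\{G(\eta_h):\eta_h\in Y_h,\ \|\eta_h\|_Y\le 1\}$. The dPG discretization is the minimization of $\Phi(\xi_h):=\tfrac12\|F-B(\xi_h)\|_{Y_h^*}^2$ over $\xi_h\in D_h$. A point $x_h\in D_h$ is called a stationary point of the dPG discretization if every directional derivative of $\Phi$ vanishes at $x_h$, i.e. $\lim_{\delta\to0}(\Phi(x_h+\delta\xi_h)-\Phi(x_h))/\delta=0$ for all $\xi_h\in X_h$. *)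

theory Defs
  imports "HOL-Analysis.Analysis"
begin

text \<open>
  The Hilbert space \<open>Y\<close> is a type of sort \<open>{real_inner, banach}\<close>, its scalar product \<open>a\<close>
  is \<open>(\<bullet>)\<close> (so that \<open>norm y = sqrt (a(y,y))\<close>), and its dual \<open>Y*\<close> is the type
  \<open>'y \<Rightarrow>\<^sub>L real\<close> of bounded linear functionals; function application is the duality bracket.
\<close>

definition fin_dim_subspace :: "'a::real_vector set \<Rightarrow> bool" where
  "fin_dim_subspace V \<longleftrightarrow> subspace V \<and> (\<exists>S. finite S \<and> span S = V)"

text \<open>The supremum is over a nonempty set that is bounded above (by \<open>norm G\<close>) for any subspace.\<close>

definition discrete_dual_norm :: "'y::real_normed_vector set \<Rightarrow> ('y \<Rightarrow>\<^sub>L real) \<Rightarrow> real" where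
  "discrete_dual_norm Yh G = Sup {blinfun_apply G \<eta> | \<eta>. \<eta> \<in> Yh \<and> norm \<eta> \<le> 1}"

definition dPG_functional ::
  "'y::real_normed_vector set \<Rightarrow> ('y \<Rightarrow>\<^sub>L real) \<Rightarrow> ('x \<Rightarrow> ('y \<Rightarrow>\<^sub>L real)) \<Rightarrow> 'x \<Rightarrow> real" where
  "dPG_functional Yh F B \<xi> = 1/2 * (discrete_dual_norm Yh (F - B \<xi>))\<^sup>2"

text \<open>
  For open \<open>D\<close>, the points \<open>x + \<delta> *\<^sub>R \<xi>\<close> lie in \<open>D \<inter> Xh\<close> for all small \<open>\<delta>\<close>, so the values of
  \<open>B\<close> outside \<open>D\<close> do not affect the limit.
\<close>

definition dPG_stationary ::
  "'x::real_normed_vector set \<Rightarrow> 'x set \<Rightarrow> 'y::real_normed_vector set \<Rightarrow> ('y \<Rightarrow>\<^sub>L real) \<Rightarrow>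
   ('x \<Rightarrow> ('y \<Rightarrow>\<^sub>L real)) \<Rightarrow> 'x \<Rightarrow> bool" where
  "dPG_stationary D Xh Yh F B x \<longleftrightarrow>
     x \<in> D \<inter> Xh \<and>
     (\<forall>\<xi>\<in>Xh. ((\<lambda>\<delta>::real. (dPG_functional Yh F B (x + \<delta> *\<^sub>R \<xi>) - dPG_functional Yh F B x) / \<delta>)
        \<longlongrightarrow> 0) (at 0))"

definition solves_mixed_problem ::
  "'x::real_normed_vector set \<Rightarrow> 'y::real_inner set \<Rightarrow> ('y \<Rightarrow>\<^sub>L real) \<Rightarrow>
   ('x \<Rightarrow> ('y \<Rightarrow>\<^sub>L real)) \<Rightarrow> ('x \<Rightarrow> ('x \<Rightarrow>\<^sub>L ('y \<Rightarrow>\<^sub>L real))) \<Rightarrow> 'x \<Rightarrow> 'y \<Rightarrow> bool" where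
  "solves_mixed_problem Xh Yh F B DB x y \<longleftrightarrow>
     (\<forall>\<eta>\<in>Yh. y \<bullet> \<eta> + blinfun_apply (B x) \<eta> = blinfun_apply F \<eta>) \<and>
     (\<forall>\<xi>\<in>Xh. blinfun_apply (blinfun_apply (DB x) \<xi>) y = 0)"

end

theory Submission
  imports Defs
begin

text \<open>
  Half the squared discrete dual norm is the Legendre transform
  \<open>G \<mapsto> sup {G \<eta> - |\<eta>|^2/2 | \<eta> \<in> Yh}\<close>. If \<open>y \<in> Yh\<close> represents \<open>G\<close> on \<open>Yh\<close>, completing the
  square under a perturbation \<open>H\<close> pins the increment at \<open>G\<close> between \<open>H y\<close> and \<open>H y + |H|^2/2\<close>.
  With \<open>H = B x - B (x + \<delta> \<xi>)\<close> this shows that the derivative of the dPG functional in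
  direction \<open>\<xi>\<close> is \<open>- b'(x; \<xi>, y)\<close>, and both claims follow.
\<close>

lemma discrete_dual_norm_upper:
  fixes Yh :: "'y::real_normed_vector set"
  assumes "\<eta> \<in> Yh" "norm \<eta> \<le> 1"
  shows "blinfun_apply G \<eta> \<le> discrete_dual_norm Yh G"
  unfolding discrete_dual_norm_def
proof (rule cSup_upper)
  show "blinfun_apply G \<eta> \<in> {blinfun_apply G \<eta> |\<eta>. \<eta> \<in> Yh \<and> norm \<eta> \<le> 1}"
    using assms by blast
  \<comment> \<open>\<open>Sup\<close> on the reals dominates the elements only of a set known to be
    bounded above; the operator norm of \<open>G\<close> supplies the bound.\<close>
  have "blinfun_apply G \<zeta> \<le> norm G" if "norm \<zeta> \<le> 1" for \<zeta>
  proof -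
    have "\<bar>blinfun_apply G \<zeta>\<bar> \<le> norm G * norm \<zeta>"
      using norm_blinfun[of G \<zeta>] by simp
    also have "\<dots> \<le> norm G"
      using that by (simp add: mult_left_le)
    finally show ?thesis by simp
  qed
  then show "bdd_above {blinfun_apply G \<eta> |\<eta>. \<eta> \<in> Yh \<and> norm \<eta> \<le> 1}"
    by (auto intro!: bdd_aboveI[where M = "norm G"])
qed

lemma discrete_dual_norm_least:
  assumes "subspace Yh"
    and "\<And>\<eta>. \<eta> \<in> Yh \<Longrightarrow> norm \<eta> \<le> 1 \<Longrightarrow> blinfun_apply G \<eta> \<le> c"
  shows "discrete_dual_norm Yh G \<le> c"
  unfolding discrete_dual_norm_def
proof (rule cSup_least)
  have "0 \<in> Yh" by (rule subspace_0[OF assms(1)])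
  then have "blinfun_apply G 0 \<in> {blinfun_apply G \<eta> |\<eta>. \<eta> \<in> Yh \<and> norm \<eta> \<le> 1}"
    by force
  then show "{blinfun_apply G \<eta> |\<eta>. \<eta> \<in> Yh \<and> norm \<eta> \<le> 1} \<noteq> {}"
    by blast
qed (use assms(2) in blast)

lemma discrete_dual_norm_nonneg:
  assumes "subspace Yh"
  shows "0 \<le> discrete_dual_norm Yh G"
  using discrete_dual_norm_upper[OF subspace_0[OF assms], of G] by simp

lemma discrete_dual_norm_bound:
  assumes "subspace Yh" "\<eta> \<in> Yh"
  shows "blinfun_apply G \<eta> \<le> discrete_dual_norm Yh G * norm \<eta>"
proof (cases "\<eta> = 0")
  case False
  have "blinfun_apply G (\<eta> /\<^sub>R norm \<eta>) \<le> discrete_dual_norm Yh G"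
    using assms False by (intro discrete_dual_norm_upper) (auto intro: subspace_scale)
  then show ?thesis
    using False by (simp add: blinfun.scaleR_right field_simps)
qed simp

text \<open>Young's inequality \<open>s * t \<le> s^2/2 + t^2/2\<close>, applied to the bound of
  \<open>G \<eta>\<close> by dual norm times norm. This is one half of the Legendre formula.\<close>

lemma half_discrete_dual_norm_sq_ge:
  assumes "subspace Yh" "\<eta> \<in> Yh"
  shows "blinfun_apply G \<eta> - (norm \<eta>)\<^sup>2 / 2 \<le> (discrete_dual_norm Yh G)\<^sup>2 / 2"
proof -
  have "2 * (discrete_dual_norm Yh G * norm \<eta>) \<le> (discrete_dual_norm Yh G)\<^sup>2 + (norm \<eta>)\<^sup>2"
    using sum_squares_bound[of "discrete_dual_norm Yh G" "norm \<eta>"] by (simp add: mult.assoc)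
  then show ?thesis
    using discrete_dual_norm_bound[OF assms, of G] by simp
qed

text \<open>The other half of the Legendre formula. Write \<open>s\<close> for the dual norm and
  test with \<open>s *\<^sub>R \<eta>\<close>, \<open>\<eta>\<close> in the unit ball:
  \<open>s * G \<eta> - s^2/2 \<le> c\<close>. Passing to the supremum over \<open>\<eta>\<close>
  turns \<open>s * G \<eta>\<close> into \<open>s^2\<close>.\<close>

lemma half_discrete_dual_norm_sq_le:
  assumes "subspace Yh"
    and le: "\<And>\<eta>. \<eta> \<in> Yh \<Longrightarrow> blinfun_apply G \<eta> - (norm \<eta>)\<^sup>2 / 2 \<le> c"
  shows "(discrete_dual_norm Yh G)\<^sup>2 / 2 \<le> c"
proof -
  define s where "s = discrete_dual_norm Yh G"
  show ?thesis
  proof (cases "s = 0")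
    \<comment> \<open>The scaling argument divides by \<open>s\<close>, so \<open>s = 0\<close> is
      settled apart: testing with 0 gives \<open>0 \<le> c\<close>.\<close>
    case True
    then show ?thesis
      using le[OF subspace_0[OF assms(1)]] by (simp add: s_def)
  next
    case False
    then have "s > 0"
      using discrete_dual_norm_nonneg[OF assms(1), of G] by (simp add: s_def)
    have "blinfun_apply G \<eta> \<le> (c + s\<^sup>2 / 2) / s" if "\<eta> \<in> Yh" "norm \<eta> \<le> 1" for \<eta>
    proof -
      have "(norm (s *\<^sub>R \<eta>))\<^sup>2 \<le> s\<^sup>2"
        using that \<open>s > 0\<close> by (intro power_mono) (auto simp: mult_left_le)
      moreover have "blinfun_apply G (s *\<^sub>R \<eta>) - (norm (s *\<^sub>R \<eta>))\<^sup>2 / 2 \<le> c"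
        by (rule le[OF subspace_scale[OF assms(1) that(1)]])
      ultimately have "blinfun_apply G \<eta> * s \<le> c + s\<^sup>2 / 2"
        by (simp add: blinfun.scaleR_right mult.commute)
      then show ?thesis
        using \<open>s > 0\<close> by (simp add: pos_le_divide_eq)
    qed
    then have "s \<le> (c + s\<^sup>2 / 2) / s"
      unfolding s_def by (rule discrete_dual_norm_least[OF assms(1)])
    then have "s\<^sup>2 \<le> c + s\<^sup>2 / 2"
      using \<open>s > 0\<close> by (simp add: pos_le_divide_eq power2_eq_square)
    then show ?thesis
      by (simp add: s_def)
  qed
qed

text \<open>Completing the square,
  \<open>G \<eta> - |\<eta>|^2/2 = |y|^2/2 - |\<eta> - y|^2/2\<close>. Splitting
  \<open>H \<eta> = H y + H (\<eta> - y)\<close>, Young's inequality bounds the last term by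
  \<open>|H|^2/2 + |\<eta> - y|^2/2\<close>, and the squares of \<open>\<eta> - y\<close>
  cancel.\<close>

lemma half_discrete_dual_norm_sq_perturb_le:
  fixes y :: "'y::real_inner"
  assumes Yh: "subspace Yh" "y \<in> Yh"
    and riesz: "\<And>\<eta>. \<eta> \<in> Yh \<Longrightarrow> blinfun_apply G \<eta> = y \<bullet> \<eta>"
  shows "(discrete_dual_norm Yh (G + H))\<^sup>2 / 2
    \<le> (norm y)\<^sup>2 / 2 + blinfun_apply H y + (norm H)\<^sup>2 / 2"
proof (rule half_discrete_dual_norm_sq_le[OF Yh(1)])
  fix \<eta> assume "\<eta> \<in> Yh"
  have "blinfun_apply H (\<eta> - y) \<le> norm H * norm (\<eta> - y)"
    using norm_blinfun[of H "\<eta> - y"] by simp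
  moreover have "2 * (norm H * norm (\<eta> - y)) \<le> (norm H)\<^sup>2 + (norm (\<eta> - y))\<^sup>2"
    using sum_squares_bound[of "norm H" "norm (\<eta> - y)"] by (simp add: mult.assoc)
  moreover have "(norm (\<eta> - y))\<^sup>2 = (norm \<eta>)\<^sup>2 - 2 * (y \<bullet> \<eta>) + (norm y)\<^sup>2"
    by (simp add: power2_norm_eq_inner inner_diff inner_commute)
  ultimately show "blinfun_apply (G + H) \<eta> - (norm \<eta>)\<^sup>2 / 2
      \<le> (norm y)\<^sup>2 / 2 + blinfun_apply H y + (norm H)\<^sup>2 / 2"
    using riesz[OF \<open>\<eta> \<in> Yh\<close>] by (simp add: blinfun.add_left blinfun.diff_right)
qed

text \<open>The maximizer \<open>y\<close> for \<open>G\<close> serves as a test vector for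
  \<open>G + H\<close>.\<close>

lemma half_discrete_dual_norm_sq_perturb_ge:
  fixes y :: "'y::real_inner"
  assumes Yh: "subspace Yh" "y \<in> Yh"
    and riesz: "\<And>\<eta>. \<eta> \<in> Yh \<Longrightarrow> blinfun_apply G \<eta> = y \<bullet> \<eta>"
  shows "(norm y)\<^sup>2 / 2 + blinfun_apply H y \<le> (discrete_dual_norm Yh (G + H))\<^sup>2 / 2"
  using half_discrete_dual_norm_sq_ge[OF Yh, of "G + H"] riesz[OF Yh(2)]
  by (simp add: blinfun.add_left power2_norm_eq_inner)

lemma half_discrete_dual_norm_sq_riesz:
  fixes y :: "'y::real_inner"
  assumes "subspace Yh" "y \<in> Yh"
    and "\<And>\<eta>. \<eta> \<in> Yh \<Longrightarrow> blinfun_apply G \<eta> = y \<bullet> \<eta>"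
  shows "(discrete_dual_norm Yh G)\<^sup>2 / 2 = (norm y)\<^sup>2 / 2"
  using half_discrete_dual_norm_sq_perturb_le[OF assms, of 0]
    half_discrete_dual_norm_sq_perturb_ge[OF assms, of 0]
  by simp

text \<open>The increment of the functional is \<open>H y\<close> up to an error quadratic in
  \<open>H\<close>. Since \<open>H\<close> is of order \<open>\<delta>\<close>, only the linear term
  survives division by \<open>\<delta>\<close>. The vector \<open>y\<close> belongs to the residual
  at \<open>x\<close> and stays fixed, so no representative at perturbed points has to be
  followed.\<close>

lemma dPG_functional_directional_derivative:
  fixes y :: "'y::real_inner" and B :: "'x::real_normed_vector \<Rightarrow> ('y \<Rightarrow>\<^sub>L real)"
  assumes deriv: "(B has_derivative B') (at x)"
    and Yh: "subspace Yh" "y \<in> Yh"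
    and riesz: "\<And>\<eta>. \<eta> \<in> Yh \<Longrightarrow> y \<bullet> \<eta> + blinfun_apply (B x) \<eta> = blinfun_apply F \<eta>"
  shows "((\<lambda>\<delta>. (dPG_functional Yh F B (x + \<delta> *\<^sub>R \<xi>) - dPG_functional Yh F B x) / \<delta>)
    \<longlongrightarrow> - blinfun_apply (B' \<xi>) y) (at 0)"
proof -
  define H where "H = (\<lambda>\<delta>. B x - B (x + \<delta> *\<^sub>R \<xi>))"
  define \<Phi> where "\<Phi> = dPG_functional Yh F B"
  have G: "blinfun_apply (F - B x) \<eta> = y \<bullet> \<eta>" if "\<eta> \<in> Yh" for \<eta>
    using riesz[OF that] by (simp add: blinfun.diff_left)
  \<comment> \<open>The perturbation bounds with \<open>G = F - B x\<close>, for which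
    \<open>G + H \<delta>\<close> is the residual at
    \<open>x + \<delta> *\<^sub>R \<xi>\<close>.\<close>
  have remainder: "\<bar>\<Phi> (x + \<delta> *\<^sub>R \<xi>) - \<Phi> x - blinfun_apply (H \<delta>) y\<bar> \<le> (norm (H \<delta>))\<^sup>2 / 2" for \<delta>
    using half_discrete_dual_norm_sq_perturb_le[OF Yh G, of "H \<delta>"]
      half_discrete_dual_norm_sq_perturb_ge[OF Yh G, of "H \<delta>"]
      half_discrete_dual_norm_sq_riesz[OF Yh G]
    by (simp add: \<Phi>_def dPG_functional_def H_def)

  interpret B': bounded_linear B'
    by (rule has_derivative_bounded_linear[OF deriv])
  have "((\<lambda>\<delta>. x + \<delta> *\<^sub>R \<xi>) has_derivative (\<lambda>\<delta>. \<delta> *\<^sub>R \<xi>)) (at (0::real))"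
    by (auto intro!: derivative_eq_intros)
  \<comment> \<open>The base point is written as the value of the inner map at 0, to fit the chain
    rule.\<close>
  moreover have "(B has_derivative B') (at (x + 0 *\<^sub>R \<xi>))"
    using deriv by simp
  ultimately have "((\<lambda>\<delta>. B (x + \<delta> *\<^sub>R \<xi>)) has_derivative (\<lambda>\<delta>. B' (\<delta> *\<^sub>R \<xi>))) (at 0)"
    by (rule has_derivative_compose)
  then have "((\<lambda>\<delta>. B (x + \<delta> *\<^sub>R \<xi>)) has_derivative (\<lambda>\<delta>. \<delta> *\<^sub>R B' \<xi>)) (at 0)"
    by (simp add: B'.scaleR)
  then have "(H has_derivative (\<lambda>\<delta>. - (\<delta> *\<^sub>R B' \<xi>))) (at 0)"
    unfolding H_def by (auto intro!: derivative_eq_intros)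
  \<comment> \<open>The definition of the derivative at 0, where \<open>H\<close> vanishes.\<close>
  then have "((\<lambda>\<delta>. norm (H \<delta> + \<delta> *\<^sub>R B' \<xi>) / \<bar>\<delta>\<bar>) \<longlongrightarrow> 0) (at 0)"
    by (simp add: has_derivative_at H_def)
  moreover have "norm (H \<delta> /\<^sub>R \<delta> - - B' \<xi>) = norm (H \<delta> + \<delta> *\<^sub>R B' \<xi>) / \<bar>\<delta>\<bar>" if "\<delta> \<noteq> 0" for \<delta>
  proof -
    have "H \<delta> /\<^sub>R \<delta> - - B' \<xi> = (H \<delta> + \<delta> *\<^sub>R B' \<xi>) /\<^sub>R \<delta>"
      using that by (simp add: scaleR_add_right)
    then show ?thesis
      by (simp add: divide_inverse mult.commute)
  qed
  ultimately have "((\<lambda>\<delta>. norm (H \<delta> /\<^sub>R \<delta> - - B' \<xi>)) \<longlongrightarrow> 0) (at 0)"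
    by (subst LIM_equal) auto
  then have quot: "((\<lambda>\<delta>. H \<delta> /\<^sub>R \<delta>) \<longlongrightarrow> - B' \<xi>) (at 0)"
    by (simp only: Lim_null[of _ "- B' \<xi>"] tendsto_norm_zero_iff)

  have main: "((\<lambda>\<delta>. blinfun_apply (H \<delta> /\<^sub>R \<delta>) y) \<longlongrightarrow> - blinfun_apply (B' \<xi>) y) (at 0)"
    using blinfun.tendsto[OF quot tendsto_const[of y]] by (simp add: blinfun.minus_left)
  \<comment> \<open>This is the quadratic remainder divided by \<open>\<bar>\<delta>\<bar>\<close>,
    rewritten as a null factor times a convergent one.\<close>
  have "((\<lambda>\<delta>. \<bar>\<delta>\<bar> * (norm (H \<delta> /\<^sub>R \<delta>))\<^sup>2 / 2) \<longlongrightarrow> \<bar>0\<bar> * (norm (- B' \<xi>))\<^sup>2 / 2) (at 0)"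
    by (intro tendsto_intros quot) simp
  then have small: "((\<lambda>\<delta>. \<bar>\<delta>\<bar> * (norm (H \<delta> /\<^sub>R \<delta>))\<^sup>2 / 2) \<longlongrightarrow> 0) (at 0)"
    by simp
  have "((\<lambda>\<delta>. (\<Phi> (x + \<delta> *\<^sub>R \<xi>) - \<Phi> x) / \<delta> - blinfun_apply (H \<delta> /\<^sub>R \<delta>) y) \<longlongrightarrow> 0) (at 0)"
  proof (rule Lim_null_comparison[OF _ small])
    show "\<forall>\<^sub>F \<delta> in at 0. norm ((\<Phi> (x + \<delta> *\<^sub>R \<xi>) - \<Phi> x) / \<delta> - blinfun_apply (H \<delta> /\<^sub>R \<delta>) y)
        \<le> \<bar>\<delta>\<bar> * (norm (H \<delta> /\<^sub>R \<delta>))\<^sup>2 / 2"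
    proof (rule eventually_at_filter[THEN iffD2], rule always_eventually, safe)
      fix \<delta> :: real assume "\<delta> \<noteq> 0"
      then have "(\<Phi> (x + \<delta> *\<^sub>R \<xi>) - \<Phi> x) / \<delta> - blinfun_apply (H \<delta> /\<^sub>R \<delta>) y
          = (\<Phi> (x + \<delta> *\<^sub>R \<xi>) - \<Phi> x - blinfun_apply (H \<delta>) y) / \<delta>"
        by (simp add: blinfun.scaleR_left field_simps)
      then have "norm ((\<Phi> (x + \<delta> *\<^sub>R \<xi>) - \<Phi> x) / \<delta> - blinfun_apply (H \<delta> /\<^sub>R \<delta>) y)
          \<le> (norm (H \<delta>))\<^sup>2 / 2 / \<bar>\<delta>\<bar>"
        using divide_right_mono[OF remainder[of \<delta>], of "\<bar>\<delta>\<bar>"] by simp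
      also have "\<dots> = \<bar>\<delta>\<bar> * (norm (H \<delta> /\<^sub>R \<delta>))\<^sup>2 / 2"
        using \<open>\<delta> \<noteq> 0\<close> by (simp add: field_simps power2_eq_square)
      finally show "norm ((\<Phi> (x + \<delta> *\<^sub>R \<xi>) - \<Phi> x) / \<delta> - blinfun_apply (H \<delta> /\<^sub>R \<delta>) y)
          \<le> \<bar>\<delta>\<bar> * (norm (H \<delta> /\<^sub>R \<delta>))\<^sup>2 / 2" .
    qed
  qed
  from tendsto_add[OF this main] show ?thesis
    by (simp add: \<Phi>_def)
qed

text \<open>The difference quotient converges to \<open>- B' \<xi> y\<close>, so by uniqueness of
  limits it tends to 0 exactly when that number is 0. Both directions of the theorem rest on this
  equivalence.\<close>

lemma dPG_stationary_iff:
  fixes y :: "'y::real_inner" and B :: "'x::real_normed_vector \<Rightarrow> ('y \<Rightarrow>\<^sub>L real)"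
  assumes "(B has_derivative B') (at x)" "x \<in> D \<inter> Xh"
    and "subspace Yh" "y \<in> Yh"
    and "\<And>\<eta>. \<eta> \<in> Yh \<Longrightarrow> y \<bullet> \<eta> + blinfun_apply (B x) \<eta> = blinfun_apply F \<eta>"
  shows "dPG_stationary D Xh Yh F B x \<longleftrightarrow> (\<forall>\<xi>\<in>Xh. blinfun_apply (B' \<xi>) y = 0)"
proof -
  have "((\<lambda>\<delta>. (dPG_functional Yh F B (x + \<delta> *\<^sub>R \<xi>) - dPG_functional Yh F B x) / \<delta>)
      \<longlongrightarrow> 0) (at 0) \<longleftrightarrow> blinfun_apply (B' \<xi>) y = 0" for \<xi>
    using dPG_functional_directional_derivative[OF assms(1,3,4,5), of \<xi>]
    by (auto dest: LIM_unique)
  then show ?thesis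
    using assms(2) by (simp add: dPG_stationary_def)
qed

theorem theorem2p2:
  fixes D Xh :: "'x::banach set"
    and Yh :: "'y::{real_inner, banach} set"
    and B :: "'x \<Rightarrow> ('y \<Rightarrow>\<^sub>L real)"
    and DB :: "'x \<Rightarrow> ('x \<Rightarrow>\<^sub>L ('y \<Rightarrow>\<^sub>L real))"
    and F :: "'y \<Rightarrow>\<^sub>L real"
  assumes "open D" and "D \<noteq> {}"
    and "\<And>x. x \<in> D \<Longrightarrow> (B has_derivative blinfun_apply (DB x)) (at x)"
    and "continuous_on D DB"
    and "fin_dim_subspace Xh" and "fin_dim_subspace Yh"
  shows "(\<forall>xh\<in>D \<inter> Xh. \<forall>yh\<in>Yh.
           dPG_stationary D Xh Yh F B xh \<longrightarrow>
           (\<forall>\<eta>\<in>Yh. yh \<bullet> \<eta> = blinfun_apply F \<eta> - blinfun_apply (B xh) \<eta>) \<longrightarrow>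
           solves_mixed_problem Xh Yh F B DB xh yh) \<and>
         (\<forall>xh\<in>D \<inter> Xh. \<forall>yh\<in>Yh.
           solves_mixed_problem Xh Yh F B DB xh yh \<longrightarrow>
           dPG_stationary D Xh Yh F B xh)"
proof -
  have Yh: "subspace Yh"
    using assms(6) by (simp add: fin_dim_subspace_def)
  show ?thesis
  proof (intro conjI ballI impI)
    fix xh yh
    assume h: "xh \<in> D \<inter> Xh" "yh \<in> Yh" "dPG_stationary D Xh Yh F B xh"
      and "\<forall>\<eta>\<in>Yh. yh \<bullet> \<eta> = blinfun_apply F \<eta> - blinfun_apply (B xh) \<eta>"
    \<comment> \<open>The Riesz equation rearranged is the first equation of the mixed problem; the
      equivalence then yields the second.\<close>
    then have riesz: "yh \<bullet> \<eta> + blinfun_apply (B xh) \<eta> = blinfun_apply F \<eta>" if "\<eta> \<in> Yh" for \<eta>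
      using that by simp
    then show "solves_mixed_problem Xh Yh F B DB xh yh"
      using dPG_stationary_iff[OF assms(3) h(1) Yh h(2) riesz] h
      by (simp add: solves_mixed_problem_def)
  next
    fix xh yh
    assume h: "xh \<in> D \<inter> Xh" "yh \<in> Yh" "solves_mixed_problem Xh Yh F B DB xh yh"
    then have riesz: "yh \<bullet> \<eta> + blinfun_apply (B xh) \<eta> = blinfun_apply F \<eta>" if "\<eta> \<in> Yh" for \<eta>
      using that by (simp add: solves_mixed_problem_def)
    then show "dPG_stationary D Xh Yh F B xh"
      using dPG_stationary_iff[OF assms(3) h(1) Yh h(2) riesz] h
      by (simp add: solves_mixed_problem_def)
  qed
qed

end
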